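(* Let $F$ and $G$ be continuous cumulative distribution functions on $\mathbb{R}$ (possibly distinct), let $X_1,X_2,\dots$ be i.i.d. real random variables with cumulative distribution function $F$, and for $n\ge 1$ let $F_n(x)=\frac1n\sum_{i=1}^n I(X_i\le x)$ be the empirical distribution function of $X_1,\dots,X_n$. Then $d(F_n,G)$ converges to $d(F,G)$ (in probability, as $n\to\infty$), with the rate of this convergence satisfying, for every $n\ge 1$ and every real $z\ge 0$, $$\mathrm{Prob}\left[\sqrt{n}\,\bigl|d(F_n,G)-d(F,G)\bigr|>z\right]\ \le\ 2e^{-2z^2}.$$
   Context: For two distribution functions $A,B$ on $\mathbb{R}$ (cumulative or empirical), the Kolmogorov-Smirnov distance is $d(A,B):=\sup_{x\in\mathbb{R}}|A(x)-B(x)|$. $I(X_i\le x)$ is the indicator, equal to $1$ if $X_i\le x$ and $0$ otherwise. *)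

theory Defs
  imports "HOL-Probability.Probability"
begin

definition distribution_function :: "(real \<Rightarrow> real) \<Rightarrow> bool" where
  "distribution_function F \<longleftrightarrow> (\<exists>\<mu>. real_distribution \<mu> \<and> cdf \<mu> = F)"

text \<open>
  The supremum is the real-valued one, so it is meaningful only if the difference of the two
  functions is bounded. This holds in particular for functions with values in the unit interval.
\<close>

definition KS_distance :: "(real \<Rightarrow> real) \<Rightarrow> (real \<Rightarrow> real) \<Rightarrow> real" where
  "KS_distance A B = (SUP x. \<bar>A x - B x\<bar>)"

text \<open>
  The sample consists of the observations with indices \<open>1, \<dots>, n\<close>; the value \<open>X 0\<close> is not used.
\<close>

definition empirical_df :: "(nat \<Rightarrow> 'a \<Rightarrow> real) \<Rightarrow> nat \<Rightarrow> 'a \<Rightarrow> real \<Rightarrow> real" where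
  "empirical_df X n \<omega> x = (1 / real n) * (\<Sum>i = 1..n. of_bool (X i \<omega> \<le> x))"

text \<open>
  Measurability is part of the definition because \<^const>\<open>measure\<close> is \<open>0\<close> on non-measurable sets.
\<close>

definition converges_in_probability ::
    "'a measure \<Rightarrow> (nat \<Rightarrow> 'a \<Rightarrow> real) \<Rightarrow> ('a \<Rightarrow> real) \<Rightarrow> bool" where
  "converges_in_probability M Y Z \<longleftrightarrow>
     (\<forall>n. Y n \<in> borel_measurable M) \<and> Z \<in> borel_measurable M \<and>
     (\<forall>\<epsilon>>0. (\<lambda>n. measure M {\<omega> \<in> space M. \<bar>Y n \<omega> - Z \<omega>\<bar> > \<epsilon>}) \<longlonglongrightarrow> 0)"

end

(*
  By the triangle inequality |d(F_n,G) - d(F,G)| <= d(F_n,F), so everything reduces to the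
  Dvoretzky-Kiefer-Wolfowitz inequality with Massart's constant, i.e. to the one-sided bound
  P(sup (F_n(t) - t) > e) <= exp(-2 n e^2) for a uniform sample, applied to F(X_i) and to 1 - F(X_i).

  Put t_k = k/n - e. If the one-sided event occurs, there is a last k at which at least (hence exactly)
  k points lie below t_k; this event A_k depends only on the points above t_k and on the number of
  those below. Adding a mass w at the bottom of the uniform law therefore multiplies the
  (unnormalised) weight of A_k by exactly (1 + w/t_k)^k. The A_k are disjoint and the total
  weight becomes (1+w)^n, so sum_k (1 + w/t_k)^k P(A_k) <= (1+w)^n. It remains to find, for each
  e, a single w with (1 + w/t)^(t+e) >= (1+w) exp(2 e^2) for all 0 < t <= 1 - e.
*)
theory Submission
  imports Defs
begin

subsection \<open>The exponent inequality\<close>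

text \<open>The expression vanishes at \<open>s = 0\<close> and its derivative is a square times a
  cubic over positive factors. It is what remains of the derivative in \<open>e\<close> of the
  exponent gap once the term depending on \<open>t\<close> takes its worst value.\<close>

lemma dkw_log_bound:
  fixes s :: real
  assumes "0 \<le> s" "s \<le> 29/50"
  shows "0 \<le> ln (3 * (3 + 4 * s) / (3 - 4 * s)^2) + 1 - 3 * (3 - 2 * s) / ((3 - 4 * s) * (3 + 2 * s)) - 4 * s"
proof -
  define g where "g = (\<lambda>s::real. ln 3 + ln (3 + 4 * s) - 2 * ln (3 - 4 * s) + 1
      - 3 * (3 - 2 * s) / ((3 - 4 * s) * (3 + 2 * s)) - 4 * s)"
  have "g 0 \<le> g s"
  proof (rule DERIV_nonneg_imp_nondecreasing[OF assms(1)])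
    fix x :: real assume "0 \<le> x" "x \<le> s"
    with assms have x: "0 \<le> x" "x \<le> 29/50" by auto
    \<comment> \<open>The cubic factor decreases for nonnegative \<open>x\<close> and has its root
      near 0.583, which is why the range stops at \<open>29/50\<close>.\<close>
    let ?d = "16 * x\<^sup>2 * (81 - 24 * x - 160 * x^2 - 64 * x^3) / ((3 - 4 * x)^2 * (3 + 4 * x) * (3 + 2 * x)^2)"
    have nz: "3 - 4 * x > 0" "3 + 2 * x > 0" "3 + 4 * x > 0" using x by auto
    have "(3 - 4 * x) * (3 + 2 * x) \<noteq> 0" using nz by simp
    hence nz2: "x * 6 + x * (x * 8) \<noteq> 9" by (simp add: algebra_simps)
    have "(g has_real_derivative (4 / (3+4 * x) + 8 / (3 - 4 * x)
        - 3 * (-2 * ((3 - 4 * x) * (3 + 2 * x)) - (3 - 2 * x) * (-6 - 16 * x)) / ((3 - 4 * x) * (3 + 2 * x))^2 - 4)) (at x)"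
      unfolding g_def using nz nz2
      by (auto intro!: derivative_eq_intros simp: power2_eq_square algebra_simps)
    also have "4 / (3+4 * x) + 8 / (3 - 4 * x)
        - 3 * (-2 * ((3 - 4 * x) * (3 + 2 * x)) - (3 - 2 * x) * (-6 - 16 * x)) / ((3 - 4 * x) * (3 + 2 * x))^2 - 4 = ?d"
      using nz by (simp add: divide_simps) algebra
    finally have "(g has_real_derivative ?d) (at x)" .
    moreover have "x^2 \<le> (29/50)^2" "x^3 \<le> (29/50)^3" using x by (intro power_mono; simp)+
    hence "0 \<le> 81 - 24 * x - 160 * x^2 - 64 * x^3" using x by (simp add: power2_eq_square power3_eq_cube)
    hence "?d \<ge> 0" using nz by (intro divide_nonneg_nonneg mult_nonneg_nonneg) auto
    ultimately show "\<exists>y. (g has_real_derivative y) (at x) \<and> 0 \<le> y" by blast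
  qed
  moreover have "g 0 = 0" by (simp add: g_def)
  moreover have "ln (3 * (3 + 4 * s) / (3 - 4 * s)^2) = ln 3 + ln (3 + 4 * s) - 2 * ln (3 - 4 * s)"
    using assms by (simp add: ln_div ln_mult ln_realpow del: distrib_left_numeral)
  ultimately show ?thesis by (simp add: g_def)
qed

text \<open>
  At \<open>t = 1/2 - e/3\<close>, where the relative entropy of \<open>t + e\<close> with respect to \<open>t\<close> is
  smallest up to higher order terms, this choice of \<open>w\<close> maximises \<open>(t + e) ln (1 + w/t) - ln (1 + w)\<close>.
  The simpler \<open>w = 2e/(1 - 2e)\<close>, suggested by the Brownian bridge, fails at third order in \<open>e\<close>.
  For fixed \<open>t\<close>, the derivative in \<open>e\<close> has the form \<open>ln z + B/z - R - 4e\<close> with only \<open>z = 1 + w/t\<close>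
  depending on \<open>t\<close>, so it is least at \<open>z = B\<close>.
\<close>

lemma dkw_exponent_small:
  fixes e t :: real
  assumes "0 \<le> e" "e \<le> 29/50" "0 < t"
  defines "w \<equiv> 6 * e / (3 - 4 * e)"
  shows "ln (1 + w) + 2 * e\<^sup>2 \<le> (t + e) * ln (1 + w / t)"
proof -
  define W where "W = (\<lambda>s::real. 6 * s / (3 - 4 * s))"
  define \<phi> where "\<phi> = (\<lambda>s. (t + s) * ln (1 + W s / t) - ln (1 + W s) - 2 * s\<^sup>2)"
  have "\<phi> 0 \<le> \<phi> e"
  \<comment> \<open>With \<open>t\<close> fixed, the gap between the two sides is \<open>0\<close>
    at \<open>e = 0\<close>, so it suffices that it grows with \<open>e\<close>.\<close>
  proof (rule DERIV_nonneg_imp_nondecreasing[OF assms(1)])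
    fix x assume "0 \<le> x" "x \<le> e"
    with assms have x: "0 \<le> x" "x \<le> 29/50" by auto
    have nz: "3 - 4 * x > 0" "3 + 2 * x > 0" "3 + 4 * x > 0" using x by auto
    define D where "D = 18 / (3 - 4 * x)^2"
    define z where "z = 1 + W x / t"
    define B where "B = 3 * (3 + 4 * x) / (3 - 4 * x)^2"
    define R where "R = 3 * (3 - 2 * x) / ((3 - 4 * x) * (3 + 2 * x))"
    have W: "(W has_real_derivative D) (at x)"
      unfolding W_def D_def using nz
      by (auto intro!: derivative_eq_intros simp: divide_simps power2_eq_square algebra_simps)
    have W0: "W x \<ge> 0" using nz x by (simp add: W_def)
    hence z: "z > 0" using assms(3) by (simp add: z_def add_pos_nonneg)
    have B: "B > 0" using nz by (simp add: B_def)
    have "(\<phi> has_real_derivative ln z + (t + x) * (D / t / z) - D / (1 + W x) - 4 * x) (at x)"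
      unfolding \<phi>_def z_def using W0 assms(3) z
      by (auto intro!: derivative_eq_intros W simp: z_def divide_simps)
    moreover have "(t + x) * (D / t / z) - D / (1 + W x) = B / z - R"
    proof -
      have p: "(3 - 4 * x) * t + 6 * x > 0" using nz x assms(3) by (simp add: add_pos_nonneg)
      have tz: "t * z = ((3 - 4 * x) * t + 6 * x) / (3 - 4 * x)"
        using nz assms(3) by (simp add: z_def W_def divide_simps) 
      have w1: "1 + W x = (3 + 2 * x) / (3 - 4 * x)" using nz by (simp add: W_def divide_simps)
      have "(t + x) * (D / t / z) = (t + x) * D / (t * z)" by simp
      moreover have "B / z = B * t / (t * z)" using assms(3) by simp
      moreover have "(t + x) * D / (t * z) - D / (1 + W x) = B * t / (t * z) - R"
        unfolding tz w1 D_def B_def R_def using nz p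
        by (simp add: divide_simps) algebra
      ultimately show ?thesis by simp
    qed
    moreover have "ln (B / z) \<le> B / z - 1" using B z by (intro ln_le_minus_one) simp
    hence "ln B + 1 \<le> ln z + B / z" using B z by (simp add: ln_div)
    moreover have "0 \<le> ln B + 1 - R - 4 * x" 
      unfolding B_def R_def using dkw_log_bound[OF x] by simp
    ultimately show "\<exists>y. (\<phi> has_real_derivative y) (at x) \<and> 0 \<le> y" 
      by (intro exI[of _ "ln z + (t + x) * (D / t / z) - D / (1 + W x) - 4 * x"]) linarith
  qed
  thus ?thesis by (simp add: \<phi>_def W_def w_def)
qed

text \<open>From \<open>e = 29/50\<close> on, \<open>w\<close> is frozen at its value \<open>6e/(3 - 4e) = 87/17\<close> there.\<close>

lemma dkw_exponent_large:
  fixes e t :: real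
  assumes "29/50 \<le> e" "0 < t" "t \<le> 1 - e"
  shows "ln (1 + 87/17) + 2 * e\<^sup>2 \<le> (t + e) * ln (1 + 87/17 / t)"
proof -
  define \<phi> where "\<phi> = (\<lambda>s. (t + s) * ln (1 + 87/17 / t) - ln (1 + 87/17) - 2 * s\<^sup>2)"
  have "\<phi> (29/50) \<le> \<phi> e"
  proof (rule DERIV_nonneg_imp_nondecreasing[OF assms(1)])
    fix x assume "29/50 \<le> x" "x \<le> e"
    have "(\<phi> has_real_derivative ln (1 + 87/17 / t) - 4 * x) (at x)"
      unfolding \<phi>_def by (auto intro!: derivative_eq_intros)
    \<comment> \<open>As \<open>348/17 = 4 * (87/17)\<close>, the facts collected here give
      \<open>ln (87/17 / t) \<ge> 3 - (4 * t - 1) = 4 * (1 - t) \<ge> 4 * e \<ge> 4 * x\<close>. The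
      factor 4 makes the tangent bound linear in \<open>t\<close> with the slope needed.\<close>
    moreover have "ln (4 * t) \<le> 4 * t - 1" using assms by (intro ln_le_minus_one) simp
    moreover have "3 \<le> ln (348/17 :: real)"
    proof -
      have "exp 3 = exp (1::real) ^ 3" by (simp flip: exp_of_nat_mult)
      also have "\<dots> \<le> (272/100) ^ 3" using e_less_272 by (intro power_mono) auto
      also have "\<dots> \<le> 348/17" by (simp add: power3_eq_cube)
      finally show ?thesis by (simp add: ln_ge_iff)
    qed
    moreover have "ln (348/17) = ln (4 * t) + ln (87/17 / t)"
      using assms by (subst ln_mult_pos[symmetric]) auto
    moreover have "ln (87/17 / t) \<le> ln (1 + 87/17 / t)"
      using assms by (simp add: add_pos_pos)
    ultimately show "\<exists>y. (\<phi> has_real_derivative y) (at x) \<and> 0 \<le> y"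
      using assms \<open>x \<le> e\<close> by (intro exI[of _ "ln (1 + 87/17 / t) - 4 * x"]) auto
  qed
  moreover have "0 \<le> \<phi> (29/50)"
    using dkw_exponent_small[of "29/50" t] assms(2) by (simp add: \<phi>_def)
  ultimately show ?thesis by (simp add: \<phi>_def)
qed

text \<open>One \<open>w\<close> has to serve all levels \<open>t\<close> at once. The switch at
  \<open>29/50\<close> lies in a narrow window: the large case uses
  \<open>4 * w \<ge> exp 3\<close>, which \<open>w = 6e/(3 - 4e)\<close> reaches near 0.5775, while
  the cubic in \<open>dkw_log_bound\<close> changes sign near 0.583.\<close>

lemma dkw_exponent:
  fixes e :: real
  assumes "0 < e"
  obtains w where "0 < w"
    "\<And>t. 0 < t \<Longrightarrow> t \<le> 1 - e \<Longrightarrow> ln (1 + w) + 2 * e\<^sup>2 \<le> (t + e) * ln (1 + w / t)"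
proof (cases "e \<le> 29/50")
  case True
  with assms show ?thesis
    by (intro that[of "6 * e / (3 - 4 * e)"] dkw_exponent_small) auto
next
  case False
  show ?thesis using False by (intro that[of "87/17"] dkw_exponent_large) auto
qed

subsection \<open>Change of weights\<close>

text \<open>Pushforward of a product weight under a coordinatewise map: the functions
  \<open>y\<close> with a given image \<open>z\<close> form a product of fibres of
  \<open>\<kappa>\<close>, and over such a product the sum of products factors.\<close>

lemma sum_PiE_image:
  fixes p :: "'b \<Rightarrow> 'c::comm_semiring_1"
  assumes "finite I" "finite J"
  shows "(\<Sum>y\<in>PiE I (\<lambda>_. J). h (restrict (\<kappa> \<circ> y) I) * (\<Prod>i\<in>I. p (y i))) =
    (\<Sum>z\<in>PiE I (\<lambda>_. \<kappa> ` J). h z * (\<Prod>i\<in>I. \<Sum>x\<in>{x\<in>J. \<kappa> x = z i}. p x))"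
proof -
  let ?P = "PiE I (\<lambda>_. J)" and ?Q = "PiE I (\<lambda>_. \<kappa> ` J)"
  let ?r = "\<lambda>y. restrict (\<kappa> \<circ> y) I"
  have "(\<Sum>y\<in>?P. h (?r y) * (\<Prod>i\<in>I. p (y i))) =
      (\<Sum>z\<in>?Q. \<Sum>y\<in>{y\<in>?P. ?r y = z}. h (?r y) * (\<Prod>i\<in>I. p (y i)))"
    using assms by (intro sum.group[symmetric] finite_PiE) auto
  also have "\<dots> = (\<Sum>z\<in>?Q. h z * (\<Prod>i\<in>I. \<Sum>x\<in>{x\<in>J. \<kappa> x = z i}. p x))"
  proof (rule sum.cong[OF refl])
    fix z assume z: "z \<in> ?Q"
    have fib: "{y\<in>?P. ?r y = z} = PiE I (\<lambda>i. {x\<in>J. \<kappa> x = z i})"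
      using z by (auto simp: PiE_iff fun_eq_iff restrict_def extensional_def)
    have "(\<Sum>y\<in>{y\<in>?P. ?r y = z}. h (?r y) * (\<Prod>i\<in>I. p (y i))) =
        h z * (\<Sum>y\<in>{y\<in>?P. ?r y = z}. \<Prod>i\<in>I. p (y i))"
      by (simp add: sum_distrib_left)
    also have "\<dots> = h z * (\<Prod>i\<in>I. \<Sum>x\<in>{x\<in>J. \<kappa> x = z i}. p x)"
      unfolding fib using assms by (subst prod_sum_PiE) auto
    finally show "(\<Sum>y\<in>{y\<in>?P. ?r y = z}. h (?r y) * (\<Prod>i\<in>I. p (y i))) = \<dots>" .
  qed
  finally show ?thesis .
qed

text \<open>Here \<open>y i\<close> is the cell of observation \<open>i\<close>, and
  \<open>y i \<le> j\<close> means that it lies at or below the level \<open>j / n - e\<close>. A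
  crossing only asks for at least \<open>k\<close> points; the equality holds at the last one and
  fixes the exponent in the change of weights.\<close>

definition last_crossing :: "'i set \<Rightarrow> nat \<Rightarrow> nat \<Rightarrow> ('i \<Rightarrow> nat) \<Rightarrow> bool" where
  "last_crossing I n k y \<longleftrightarrow> card {i\<in>I. y i \<le> k} = k \<and> (\<forall>j\<in>{k<..n}. card {i\<in>I. y i \<le> j} < j)"

text \<open>The map \<open>max k\<close> merges the cells up to \<open>k\<close> without affecting
  the event. Exactly \<open>k\<close> coordinates land in the merged cell, each contributing
  \<open>sum p {..k}\<close>, so the weights up to \<open>k\<close> enter only through this
  power.\<close>

lemma sum_last_crossing_collapse:
  fixes p :: "nat \<Rightarrow> real"
  assumes "finite I" "k \<le> m"
  shows "(\<Sum>y\<in>{y\<in>PiE I (\<lambda>_. {..m}). last_crossing I n k y}. \<Prod>i\<in>I. p (y i)) =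
    sum p {..k} ^ k * (\<Sum>z\<in>{z\<in>PiE I (\<lambda>_. {k..m}). last_crossing I n k z}. \<Prod>i\<in>{i\<in>I. z i \<noteq> k}. p (z i))"
proof -
  let ?P = "PiE I (\<lambda>_. {..m})" and ?Q = "PiE I (\<lambda>_. {k..m})"
  let ?h = "\<lambda>y. of_bool (last_crossing I n k y) :: real"
  have im: "max k ` {..m} = {k..m}"
    using assms(2) by (auto simp: image_iff max_def intro: bexI)
  have inv: "last_crossing I n k (restrict (max k \<circ> y) I) = last_crossing I n k y" for y
  proof -
    have "{i\<in>I. restrict (max k \<circ> y) I i \<le> j} = {i\<in>I. y i \<le> j}" if "k \<le> j" for j
      using that by auto
    thus ?thesis by (auto simp: last_crossing_def)
  qed
  have "(\<Sum>y\<in>{y\<in>?P. last_crossing I n k y}. \<Prod>i\<in>I. p (y i)) = (\<Sum>y\<in>?P. ?h y * (\<Prod>i\<in>I. p (y i)))"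
    using assms by (intro sum.mono_neutral_cong_left finite_PiE) auto
  also have "\<dots> = (\<Sum>y\<in>?P. ?h (restrict (max k \<circ> y) I) * (\<Prod>i\<in>I. p (y i)))"
    by (simp only: inv)
  also have "\<dots> = (\<Sum>z\<in>?Q. ?h z * (\<Prod>i\<in>I. \<Sum>x\<in>{x\<in>{..m}. max k x = z i}. p x))"
    using assms by (subst sum_PiE_image) (auto simp: im)
  also have "\<dots> = (\<Sum>z\<in>{z\<in>?Q. last_crossing I n k z}. \<Prod>i\<in>I. \<Sum>x\<in>{x\<in>{..m}. max k x = z i}. p x)"
    using assms by (intro sum.mono_neutral_cong_right finite_PiE) auto
  also have "\<dots> = (\<Sum>z\<in>{z\<in>?Q. last_crossing I n k z}.
      sum p {..k} ^ k * (\<Prod>i\<in>{i\<in>I. z i \<noteq> k}. p (z i)))"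
  proof (rule sum.cong[OF refl])
    fix z assume "z \<in> {z\<in>?Q. last_crossing I n k z}"
    hence z: "z \<in> ?Q" and lc: "card {i\<in>I. z i \<le> k} = k" by (auto simp: last_crossing_def)
    let ?S = "\<lambda>i. {x\<in>{..m}. max k x = z i}"
    have eq: "{i\<in>I. z i \<le> k} = {i\<in>I. z i = k}" using z by (force simp: PiE_iff)
    have "(\<Prod>i\<in>I. sum p (?S i)) = (\<Prod>i\<in>I. if z i = k then sum p {..k} else p (z i))"
    proof (rule prod.cong[OF refl])
      fix i assume "i \<in> I"
      hence "k \<le> z i" "z i \<le> m" using z by (auto simp: PiE_iff)
      hence "?S i = (if z i = k then {..k} else {z i})" using assms(2) by (auto simp: max_def split: if_splits)
      thus "sum p (?S i) = (if z i = k then sum p {..k} else p (z i))" by simp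
    qed
    also have "\<dots> = sum p {..k} ^ card {i\<in>I. z i = k} * (\<Prod>i\<in>{i\<in>I. z i \<noteq> k}. p (z i))"
      using assms(1) by (simp add: prod.If_cases Int_def)
    finally show "(\<Prod>i\<in>I. sum p (?S i)) = sum p {..k} ^ k * (\<Prod>i\<in>{i\<in>I. z i \<noteq> k}. p (z i))"
      using lc eq by simp
  qed
  finally show ?thesis by (simp add: sum_distrib_left)
qed

text \<open>Extra mass \<open>w\<close> in cell 0 multiplies the weight of the \<open>k\<close>-th
  last-crossing event by \<open>(1 + w / sum p {..k}) ^ k\<close>, hence by at least
  \<open>a\<close>. These events are disjoint, so together they weigh at most the new total
  mass.\<close>

lemma crossing_weight_bound:
  fixes p :: "nat \<Rightarrow> real"
  assumes "finite I" "card I \<le> m" and p: "\<And>j. j \<le> m \<Longrightarrow> p j \<ge> 0" "sum p {..m} = 1" and "w \<ge> 0"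
    and K: "\<And>k. l \<le> k \<Longrightarrow> k \<le> card I \<Longrightarrow> sum p {..k} > 0 \<and> a \<le> (1 + w / sum p {..k}) ^ k"
    and "a \<ge> 0"
  shows "a * (\<Sum>y\<in>{y\<in>PiE I (\<lambda>_. {..m}). \<exists>k\<in>{l..card I}. k \<le> card {i\<in>I. y i \<le> k}}. \<Prod>i\<in>I. p (y i))
     \<le> (1 + w) ^ card I"
proof -
  define n where "n = card I"
  let ?P = "PiE I (\<lambda>_. {..m})"
  define A where "A k = {y\<in>?P. last_crossing I n k y}" for k
  \<comment> \<open>The mass goes to the lowest cell so that every partial sum grows by the same
    \<open>w\<close>.\<close>
  define v where "v j = p j + (if j = 0 then w else 0)" for j :: nat
  have finP: "finite ?P" using assms(1) by (intro finite_PiE) auto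
  have finA: "finite (A k)" for k unfolding A_def using finP by simp
  have p0: "(\<Prod>i\<in>I. p (y i)) \<ge> 0" and v0: "(\<Prod>i\<in>I. v (y i)) \<ge> 0" if "y \<in> ?P" for y
    using that p(1) \<open>w \<ge> 0\<close> by (auto intro!: prod_nonneg simp: PiE_iff v_def)
  have sv: "sum v {..k} = sum p {..k} + w" for k
    by (simp add: v_def sum.distrib)
  have tilt: "(\<Sum>y\<in>A k. \<Prod>i\<in>I. v (y i)) = (1 + w / sum p {..k}) ^ k * (\<Sum>y\<in>A k. \<Prod>i\<in>I. p (y i))"
    if k: "l \<le> k" "k \<le> n" for k
  proof -
    let ?R = "\<lambda>p. \<Sum>z\<in>{z\<in>PiE I (\<lambda>_. {k..m}). last_crossing I n k z}. \<Prod>i\<in>{i\<in>I. z i \<noteq> k}. p (z i)"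
    have km: "k \<le> m" using k assms(2) by (simp add: n_def)
    \<comment> \<open>The cells in these products lie strictly above \<open>k\<close>, so cell 0,
      the only one where \<open>v\<close> and \<open>p\<close> differ, never occurs.\<close>
    have R: "?R v = ?R p"
      by (intro sum.cong prod.cong refl) (force simp: v_def PiE_iff)
    have pos: "sum p {..k} > 0" using K k by (simp add: n_def)
    have "(\<Sum>y\<in>A k. \<Prod>i\<in>I. v (y i)) = (sum p {..k} + w) ^ k * ?R p"
      unfolding A_def sum_last_crossing_collapse[OF assms(1) km] sv R ..
    also have "sum p {..k} + w = (1 + w / sum p {..k}) * sum p {..k}"
      using pos by (simp add: field_simps)
    also have "\<dots> ^ k * ?R p = (1 + w / sum p {..k}) ^ k * (sum p {..k} ^ k * ?R p)"
      by (simp add: power_mult_distrib)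
    also have "sum p {..k} ^ k * ?R p = (\<Sum>y\<in>A k. \<Prod>i\<in>I. p (y i))"
      unfolding A_def sum_last_crossing_collapse[OF assms(1) km] ..
    finally show ?thesis .
  qed
  have disj: "A j \<inter> A k = {}" if "j < k" "k \<le> n" for j k
    using that by (auto simp: A_def last_crossing_def dest!: bspec[of _ _ k])
  have cover: "{y\<in>?P. \<exists>k\<in>{l..n}. k \<le> card {i\<in>I. y i \<le> k}} \<subseteq> (\<Union>k\<in>{l..n}. A k)"
  proof
    fix y assume y: "y \<in> {y\<in>?P. \<exists>k\<in>{l..n}. k \<le> card {i\<in>I. y i \<le> k}}"
    define N where "N j = card {i\<in>I. y i \<le> j}" for j
    define C where "C = {k\<in>{l..n}. k \<le> N k}"
    have C: "finite C" "C \<noteq> {}" using y by (auto simp: C_def N_def)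
    define k where "k = Max C"
    have kC: "k \<in> C" unfolding k_def using C by (rule Max_in)
    have above: "N j < j" if "k < j" "j \<le> n" for j
    proof (rule ccontr)
      assume "\<not> N j < j"
      hence "j \<in> C" using that kC by (auto simp: C_def)
      hence "j \<le> k" unfolding k_def using C by simp
      thus False using that by simp
    qed
    \<comment> \<open>Membership in \<open>C\<close> gives the reverse inequality. Counts are
      monotone and the next one is below \<open>k + 1\<close>; at \<open>k = n\<close> the sample
      size is the bound.\<close>
    have "N k \<le> k"
    proof (cases "k < n")
      case True
      have "N k \<le> N (Suc k)" unfolding N_def using assms(1) by (intro card_mono) auto
      thus ?thesis using above[of "Suc k"] True by simp
    next
      case False
      have "N k \<le> n" unfolding N_def n_def using assms(1) by (intro card_mono) auto
      thus ?thesis using False by simp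
    qed
    hence "last_crossing I n k y"
      using above kC by (auto simp: last_crossing_def N_def C_def)
    thus "y \<in> (\<Union>k\<in>{l..n}. A k)" using y kC by (auto simp: A_def C_def)
  qed
  have "(\<Sum>y\<in>{y\<in>?P. \<exists>k\<in>{l..n}. k \<le> card {i\<in>I. y i \<le> k}}. \<Prod>i\<in>I. p (y i)) \<le>
      (\<Sum>y\<in>(\<Union>k\<in>{l..n}. A k). \<Prod>i\<in>I. p (y i))"
    using cover finA p0 by (intro sum_mono2) (auto simp: A_def)
  also have "\<dots> = (\<Sum>k\<in>{l..n}. \<Sum>y\<in>A k. \<Prod>i\<in>I. p (y i))"
    using finA disj by (intro sum.UNION_disjoint) (auto simp: Int_commute neq_iff, blast+)
  finally have "a * (\<Sum>y\<in>{y\<in>?P. \<exists>k\<in>{l..n}. k \<le> card {i\<in>I. y i \<le> k}}. \<Prod>i\<in>I. p (y i)) \<le>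
      (\<Sum>k\<in>{l..n}. a * (\<Sum>y\<in>A k. \<Prod>i\<in>I. p (y i)))"
    using \<open>a \<ge> 0\<close> by (simp add: mult_left_mono flip: sum_distrib_left)
  also have "\<dots> \<le> (\<Sum>k\<in>{l..n}. \<Sum>y\<in>A k. \<Prod>i\<in>I. v (y i))"
  proof (rule sum_mono)
    fix k assume k: "k \<in> {l..n}"
    have "0 \<le> (\<Sum>y\<in>A k. \<Prod>i\<in>I. p (y i))" using p0 by (intro sum_nonneg) (auto simp: A_def)
    thus "a * (\<Sum>y\<in>A k. \<Prod>i\<in>I. p (y i)) \<le> (\<Sum>y\<in>A k. \<Prod>i\<in>I. v (y i))"
      using k K[of k] by (auto simp: tilt n_def intro: mult_right_mono)
  qed
  also have "\<dots> = (\<Sum>y\<in>(\<Union>k\<in>{l..n}. A k). \<Prod>i\<in>I. v (y i))"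
    using finA disj by (intro sum.UNION_disjoint[symmetric]) (auto simp: Int_commute neq_iff, blast+)
  also have "\<dots> \<le> (\<Sum>y\<in>?P. \<Prod>i\<in>I. v (y i))"
    using finP v0 by (intro sum_mono2) (auto simp: A_def)
  also have "\<dots> = (\<Prod>i\<in>I. sum v {..m})"
    using assms(1) by (subst prod_sum_PiE) auto
  also have "\<dots> = (1 + w) ^ n" using p(2) by (simp add: sv n_def)
  finally show ?thesis by (simp add: n_def)
qed

text \<open>Turns probabilities into the finite weighted sums above: the event is the disjoint union
  over \<open>E\<close> of joint level sets, whose probabilities factor by independence.\<close>

lemma (in prob_space) prob_indep_finite_range:
  assumes ind: "indep_vars (\<lambda>_. count_space UNIV) Y I" and "finite I" "I \<noteq> {}" "finite S"
    and Y: "\<And>i \<omega>. i \<in> I \<Longrightarrow> \<omega> \<in> space M \<Longrightarrow> Y i \<omega> \<in> S" and E: "E \<subseteq> PiE I (\<lambda>_. S)"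
  shows "prob {\<omega>\<in>space M. restrict (\<lambda>i. Y i \<omega>) I \<in> E} =
    (\<Sum>y\<in>E. \<Prod>i\<in>I. prob {\<omega>\<in>space M. Y i \<omega> = y i})"
    and "{\<omega>\<in>space M. restrict (\<lambda>i. Y i \<omega>) I \<in> E} \<in> events"
proof -
  define B where "B y = (\<Inter>i\<in>I. Y i -` {y i} \<inter> space M)" for y
  have finE: "finite E" using E assms(2,4) by (rule finite_subset[OF _ finite_PiE])
  have meas: "Y i \<in> M \<rightarrow>\<^sub>M count_space UNIV" if "i \<in> I" for i
    using ind that by (auto simp: indep_vars_def)
  have B: "B y \<in> events" for y
    unfolding B_def using assms(2,3) meas by (intro sets.finite_INT measurable_sets) auto
  have eq: "{\<omega>\<in>space M. restrict (\<lambda>i. Y i \<omega>) I \<in> E} = (\<Union>y\<in>E. B y)"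
  proof safe
    fix \<omega> assume "\<omega> \<in> space M" "restrict (\<lambda>i. Y i \<omega>) I \<in> E"
    thus "\<omega> \<in> (\<Union>y\<in>E. B y)" by (intro UN_I[of "restrict (\<lambda>i. Y i \<omega>) I"]) (auto simp: B_def)
  next
    fix \<omega> y assume *: "y \<in> E" "\<omega> \<in> B y"
    hence "restrict (\<lambda>i. Y i \<omega>) I = restrict y I"
      by (intro restrict_ext) (unfold B_def, blast)
    also have "\<dots> = y" using * E by (intro PiE_restrict) blast
    finally have "restrict (\<lambda>i. Y i \<omega>) I = y" .
    thus "restrict (\<lambda>i. Y i \<omega>) I \<in> E" using * by simp
    show "\<omega> \<in> space M" using * assms(3) by (auto simp: B_def)
  qed
  show "{\<omega>\<in>space M. restrict (\<lambda>i. Y i \<omega>) I \<in> E} \<in> events"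
    unfolding eq using finE B by auto
  have "disjoint_family_on B E"
    unfolding disjoint_family_on_def
  proof (intro ballI impI)
    fix y z assume yz: "y \<in> E" "z \<in> E" "y \<noteq> z"
    then obtain i where "i \<in> I" "y i \<noteq> z i" using E PiE_ext[of y I "\<lambda>_. S" z] by blast
    thus "B y \<inter> B z = {}" by (auto simp: B_def)
  qed
  hence "prob (\<Union>y\<in>E. B y) = (\<Sum>y\<in>E. prob (B y))"
    using finE B by (intro finite_measure_finite_Union) auto
  also have "\<dots> = (\<Sum>y\<in>E. \<Prod>i\<in>I. prob (Y i -` {y i} \<inter> space M))"
    unfolding B_def using assms by (intro sum.cong refl indep_varsD_finite[OF ind]) auto
  also have "\<dots> = (\<Sum>y\<in>E. \<Prod>i\<in>I. prob {\<omega>\<in>space M. Y i \<omega> = y i})"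
    by (intro sum.cong prod.cong refl arg_cong[where f = prob]) auto
  finally show "prob {\<omega>\<in>space M. restrict (\<lambda>i. Y i \<omega>) I \<in> E} = \<dots>" by (simp only: eq)
qed

subsection \<open>Uniform samples\<close>

text \<open>The one-sided inequality for uniform samples. Counts are tested only at the levels
  \<open>k / n - e\<close>, so rounding each observation up to the next level loses nothing and
  leaves a finite problem. The condition \<open>n * e < k\<close> says that the level is
  positive.\<close>

lemma (in prob_space) uniform_crossing_bound:
  fixes U :: "'i \<Rightarrow> 'a \<Rightarrow> real"
  assumes ind: "indep_vars (\<lambda>_. borel) U I" and "finite I" "I \<noteq> {}" and "0 < e"
    and le1: "\<And>i \<omega>. i \<in> I \<Longrightarrow> \<omega> \<in> space M \<Longrightarrow> U i \<omega> \<le> 1"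
    and unif: "\<And>i t. i \<in> I \<Longrightarrow> prob {\<omega>\<in>space M. U i \<omega> \<le> t} = min 1 (max 0 t)"
  defines "n \<equiv> card I"
  defines "E \<equiv> {\<omega>\<in>space M. \<exists>k\<le>n. n * e < k \<and> k \<le> card {i\<in>I. U i \<omega> \<le> k / n - e}}"
  shows "prob E \<le> exp (- 2 * real n * e\<^sup>2)" and "E \<in> events"
proof -
  have n: "n > 0" using assms(2,3) by (simp add: n_def card_gt_0_iff)
  \<comment> \<open>No cell index exceeds \<open>m\<close>, since
    \<open>U i \<omega> \<le> 1\<close>; \<open>l\<close> is the least \<open>k\<close> whose level
    is positive.\<close>
  define m where "m = nat \<lceil>n * (1 + e)\<rceil>"
  define l where "l = nat \<lfloor>n * e\<rfloor> + 1"
  \<comment> \<open>The index of the first level at or above \<open>U i \<omega>\<close>;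
    \<open>nat\<close> sends everything at or below \<open>-e\<close> to cell 0.\<close>
  define Y where "Y i \<omega> = nat \<lceil>n * (U i \<omega> + e)\<rceil>" for i \<omega>
  have Y_le: "Y i \<omega> \<le> j \<longleftrightarrow> U i \<omega> \<le> j / n - e" for i \<omega> j
    using n by (simp add: Y_def nat_le_iff ceiling_le_iff field_simps)
  have Um: "U i \<in> borel_measurable M" if "i \<in> I" for i
    using ind that by (auto simp: indep_vars_def)
  have indY: "indep_vars (\<lambda>_. count_space UNIV) Y I"
    unfolding Y_def using ind by (rule indep_vars_compose2) measurable
  have l_le: "l \<le> k \<longleftrightarrow> n * e < k" for k
    using assms(4) by (simp add: l_def Suc_le_eq nat_less_iff floor_less_iff)
  have nm: "n \<le> m"
  proof -
    have "real n \<le> n * (1 + e)" using assms(4) by (simp add: distrib_left)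
    thus ?thesis unfolding m_def by linarith
  qed
  \<comment> \<open>The uniform distribution function at level \<open>k\<close>, clamped because
    levels are negative for small \<open>k\<close> and may exceed 1 at \<open>m\<close>. As
    \<open>T 0 = 0\<close>, the mass \<open>w\<close> is added to a cell of probability 0.\<close>
  define T where "T k = min 1 (max 0 (k / n - e))" for k :: nat
  define p where "p k = T k - (if k = 0 then 0 else T (k - 1))" for k
  have T_mono: "T j \<le> T k" if "j \<le> k" for j k
  proof -
    have "real j / n \<le> k / n" using that by (simp add: divide_right_mono)
    thus ?thesis unfolding T_def by linarith
  qed
  have sum_p: "sum p {..k} = T k" for k
    by (induction k) (auto simp: p_def)
  have probY: "prob {\<omega>\<in>space M. Y i \<omega> = k} = p k" if i: "i \<in> I" for i k
  proof (cases "k = 0")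
    case True
    have "{\<omega>\<in>space M. Y i \<omega> = k} = {\<omega>\<in>space M. U i \<omega> \<le> real k / n - e}"
      using True Y_le[of i _ 0] by auto
    thus ?thesis using True unif[OF i] by (simp add: p_def T_def)
  next
    case False
    have "{\<omega>\<in>space M. Y i \<omega> = k} = {\<omega>\<in>space M. U i \<omega> \<le> k / n - e} - {\<omega>\<in>space M. U i \<omega> \<le> (k - 1 :: nat) / n - e}"
    proof -
      have "Y i \<omega> = k \<longleftrightarrow> Y i \<omega> \<le> k \<and> \<not> Y i \<omega> \<le> k - 1" for \<omega>
        using False by linarith
      thus ?thesis unfolding Y_le by blast
    qed
    also have "prob \<dots> = prob {\<omega>\<in>space M. U i \<omega> \<le> k / n - e} - prob {\<omega>\<in>space M. U i \<omega> \<le> (k - 1 :: nat) / n - e}"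
    proof (rule finite_measure_Diff)
      have "(k - 1 :: nat) / n - e \<le> k / n - e" by (simp add: divide_right_mono)
      thus "{\<omega>\<in>space M. U i \<omega> \<le> (k - 1 :: nat) / n - e} \<subseteq> {\<omega>\<in>space M. U i \<omega> \<le> k / n - e}"
        by auto
    qed (use Um[OF i] in auto)
    finally show ?thesis using False unif[OF i] by (simp add: p_def T_def)
  qed
  have "m \<ge> n * (1 + e)" unfolding m_def by linarith
  hence Tm: "T m = 1" using n by (auto simp: T_def field_simps)
  obtain w where w: "0 < w"
    "\<And>t. 0 < t \<Longrightarrow> t \<le> 1 - e \<Longrightarrow> ln (1 + w) + 2 * e\<^sup>2 \<le> (t + e) * ln (1 + w / t)"
    using dkw_exponent[OF assms(4)] by metis
  \<comment> \<open>Chosen so that cancelling \<open>(1 + w) ^ n\<close> at the end leaves exactly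
    the exponential bound.\<close>
  define a where "a = (1 + w) ^ n * exp (2 * real n * e\<^sup>2)"
  have K: "sum p {..k} > 0 \<and> a \<le> (1 + w / sum p {..k}) ^ k" if k: "l \<le> k" "k \<le> n" for k
  proof -
    define t where "t = k / n - e"
    have t: "0 < t" "t \<le> 1 - e" using k n by (auto simp: l_le t_def field_simps)
    have Tk: "T k = t" using t assms(4) by (auto simp: T_def t_def)
    \<comment> \<open>This turns \<open>n\<close> times the exponent \<open>t + e\<close> into the
      \<open>k\<close>-th power required by \<open>crossing_weight_bound\<close>.\<close>
    have nk: "n * (t + e) = k" using n by (simp add: t_def)
    have "n * (ln (1 + w) + 2 * e\<^sup>2) = n * ln (1 + w) + 2 * real n * e\<^sup>2" by (simp add: algebra_simps)
    hence "a = exp (n * (ln (1 + w) + 2 * e\<^sup>2))"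
      using w(1) by (simp add: a_def exp_add exp_of_nat_mult)
    also have "\<dots> \<le> exp (n * ((t + e) * ln (1 + w / t)))"
      using w(2)[OF t] by (simp add: mult_left_mono)
    also have "\<dots> = exp (k * ln (1 + w / t))" unfolding mult.assoc[symmetric] nk ..
    also have "\<dots> = (1 + w / t) ^ k" using w(1) t by (simp add: exp_of_nat_mult add_pos_pos)
    finally show ?thesis using t by (simp add: sum_p Tk)
  qed
  define S where "S = {y\<in>PiE I (\<lambda>_. {..m}). \<exists>k\<in>{l..n}. k \<le> card {i\<in>I. y i \<le> k}}"
  have YS: "Y i \<omega> \<in> {..m}" if "i \<in> I" "\<omega> \<in> space M" for i \<omega>
  proof -
    have "n * (U i \<omega> + e) \<le> n * (1 + e)" using le1[OF that] by (intro mult_left_mono) auto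
    thus ?thesis unfolding Y_def m_def atMost_iff by (intro nat_mono ceiling_mono)
  qed
  have E_eq: "E = {\<omega>\<in>space M. restrict (\<lambda>i. Y i \<omega>) I \<in> S}"
  proof -
    have "restrict (\<lambda>i. Y i \<omega>) I \<in> S \<longleftrightarrow> (\<exists>k\<le>n. n * e < k \<and> k \<le> card {i\<in>I. U i \<omega> \<le> k / n - e})"
      if "\<omega> \<in> space M" for \<omega>
    proof -
      have "{i\<in>I. restrict (\<lambda>i. Y i \<omega>) I i \<le> k} = {i\<in>I. U i \<omega> \<le> k / n - e}" for k :: nat
        by (auto simp: Y_le)
      thus ?thesis using YS that by (auto simp: S_def l_le Bex_def)
    qed
    thus ?thesis by (auto simp: E_def)
  qed
  have fr: "prob E = (\<Sum>y\<in>S. \<Prod>i\<in>I. prob {\<omega>\<in>space M. Y i \<omega> = y i})" "E \<in> events"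
    unfolding E_eq using YS by (intro prob_indep_finite_range[OF indY assms(2,3), of "{..m}"]; auto simp: S_def)+
  show "E \<in> events" by fact
  have p0: "p k \<ge> 0" for k using T_mono[of "k - 1" k] by (auto simp: p_def T_def)
  have "prob E = (\<Sum>y\<in>S. \<Prod>i\<in>I. p (y i))" by (simp add: fr(1) probY)
  moreover have "a * (\<Sum>y\<in>S. \<Prod>i\<in>I. p (y i)) \<le> (1 + w) ^ n"
    unfolding S_def n_def
  proof (rule crossing_weight_bound)
    show "sum p {..m} = 1" using Tm by (simp add: sum_p)
    show "a \<ge> 0" using w(1) by (simp add: a_def)
  qed (use assms(2) nm w(1) K p0 in \<open>auto simp: n_def\<close>)
  ultimately have "(1 + w) ^ n * (exp (2 * real n * e\<^sup>2) * prob E) \<le> (1 + w) ^ n * 1"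
    by (simp add: a_def mult.assoc)
  hence "exp (2 * real n * e\<^sup>2) * prob E \<le> 1"
    by (rule mult_left_le_imp_le) (use w(1) in simp)
  thus "prob E \<le> exp (- 2 * real n * e\<^sup>2)" by (simp add: exp_minus field_simps)
qed

subsection \<open>Empirical distribution functions\<close>

lemma continuous_distribution_function_attains:
  assumes "distribution_function F" "continuous_on UNIV F" "0 < t" "t < 1"
  obtains x where "F x = t"
proof -
  from assms(1) obtain \<mu> where \<mu>: "real_distribution \<mu>" "cdf \<mu> = F"
    by (auto simp: distribution_function_def)
  interpret real_distribution \<mu> by fact
  have "eventually (\<lambda>x. F x < t) at_bot" "eventually (\<lambda>x. F x > t) at_top"
    using order_tendstoD(2)[OF cdf_lim_at_bot \<open>0 < t\<close>] order_tendstoD(1)[OF cdf_lim_at_top_prob \<open>t < 1\<close>]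
    by (simp_all add: \<mu>)
  then obtain a b where ab: "\<And>x. x \<le> a \<Longrightarrow> F x < t" "\<And>x. x \<ge> b \<Longrightarrow> F x > t"
    by (auto simp: eventually_at_bot_linorder eventually_at_top_linorder)
  have "F (min a b) \<le> t" "t \<le> F (max a b)"
    using ab(1)[of "min a b"] ab(2)[of "max a b"] by auto
  moreover have "continuous_on {min a b..max a b} F"
    using assms(2) by (rule continuous_on_subset) simp
  moreover have "min a b \<le> max a b" by simp
  ultimately obtain x where "F x = t" using IVT'[of F "min a b" t "max a b"] by blast
  thus ?thesis by (rule that)
qed

lemma distribution_function_bounds:
  assumes "distribution_function F"
  shows "0 \<le> F x" "F x \<le> 1" "mono F"
proof -
  from assms obtain \<mu> where \<mu>: "real_distribution \<mu>" "cdf \<mu> = F"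
    by (auto simp: distribution_function_def)
  interpret real_distribution \<mu> by fact
  show "0 \<le> F x" "F x \<le> 1" "mono F"
    using cdf_nonneg[of x] cdf_bounded_prob[of x] cdf_nondecreasing by (auto simp: \<mu> mono_def)
qed

lemma distribution_function_range: "distribution_function F \<Longrightarrow> range F \<subseteq> {0..1}"
  using distribution_function_bounds(1,2) by auto

text \<open>\<open>F\<close> may be constant on intervals, so
  \<open>F (X \<omega>) \<le> F x\<close> is not equivalent to \<open>X \<omega> \<le> x\<close>.
  Monotonicity gives only \<open>lt t \<le> t \<le> le t\<close>; equality follows by comparing
  neighbouring levels. The version with \<open>1 - F\<close> rests on \<open>lt\<close>.\<close>

lemma (in prob_space) probability_integral_transform:
  assumes F: "distribution_function F" "continuous_on UNIV F"
    and X: "X \<in> borel_measurable M" "cdf (distr M borel X) = F"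
  shows "prob {\<omega>\<in>space M. F (X \<omega>) \<le> t} = min 1 (max 0 t)"
    and "prob {\<omega>\<in>space M. 1 - F (X \<omega>) \<le> t} = min 1 (max 0 t)"
proof -
  note F01 = distribution_function_bounds[OF F(1)]
  have [measurable]: "F \<in> borel_measurable borel"
    using F(2) by (rule borel_measurable_continuous_onI)
  note X(1)[measurable]
  have cdfX: "prob {\<omega>\<in>space M. X \<omega> \<le> x} = F x" for x
  proof -
    have "F x = prob (X -` {..x} \<inter> space M)"
      unfolding X(2)[symmetric] cdf_def by (intro measure_distr) auto
    also have "X -` {..x} \<inter> space M = {\<omega>\<in>space M. X \<omega> \<le> x}" by auto
    finally show ?thesis by simp
  qed
  define le lt where "le t = prob {\<omega>\<in>space M. F (X \<omega>) \<le> t}" and "lt t = prob {\<omega>\<in>space M. F (X \<omega>) < t}" for t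
  have bounds: "lt t \<le> t" "t \<le> le t" if t: "0 < t" "t < 1" for t
  proof -
    obtain x where x: "F x = t" using continuous_distribution_function_attains[OF F t] .
    have "X \<omega> \<le> x" if "F (X \<omega>) < t" for \<omega>
      using that x monoD[OF F01(3), of x "X \<omega>"] by (cases "X \<omega> \<le> x") auto
    hence "lt t \<le> prob {\<omega>\<in>space M. X \<omega> \<le> x}"
      unfolding lt_def by (intro finite_measure_mono) auto
    thus "lt t \<le> t" by (simp only: cdfX x)
    have "prob {\<omega>\<in>space M. X \<omega> \<le> x} \<le> le t"
      unfolding le_def using monoD[OF F01(3)] x by (intro finite_measure_mono) auto
    thus "t \<le> le t" by (simp only: cdfX x)
  qed
  have step: "le s \<le> lt t" if "s < t" for s t
    unfolding le_def lt_def using that by (intro finite_measure_mono) auto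
  have range: "0 \<le> le t" "le t \<le> 1" "0 \<le> lt t" "lt t \<le> 1" for t by (auto simp: le_def lt_def)
  \<comment> \<open>For \<open>t < s < 1\<close>, \<open>le t \<le> lt s \<le> s\<close>; then
    \<open>s\<close> decreases to \<open>t\<close>. The lower bound for \<open>lt\<close> is
    symmetric.\<close>
  have upper: "le t \<le> t" if "0 \<le> t" "t < 1" for t
  proof (rule dense_ge_bounded[OF that(2)])
    fix s assume "t < s" "s < 1"
    thus "le t \<le> s" using step[of t s] bounds(1)[of s] that by auto
  qed
  have lower: "t \<le> lt t" if "0 < t" "t \<le> 1" for t
  proof (rule dense_le_bounded[OF that(1)])
    fix s assume "0 < s" "s < t"
    thus "s \<le> lt t" using step[of s t] bounds(2)[of s] that by auto
  qed
  have le1: "le t = 1" if "t \<ge> 1" for t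
  proof -
    have "{\<omega>\<in>space M. F (X \<omega>) \<le> t} = space M" using order_trans[OF F01(2) that] by auto
    thus ?thesis by (simp add: le_def prob_space)
  qed
  have lt0: "lt t = 0" if "t \<le> 0" for t
  proof -
    have "{\<omega>\<in>space M. F (X \<omega>) < t} = {}" using order_trans[OF that F01(1)] by (auto simp: not_less)
    thus ?thesis unfolding lt_def by (simp only: measure_empty)
  qed
  have le: "le t = min 1 (max 0 t)" for t
  proof -
    consider "t < 0" | "0 \<le> t" "t < 1" | "t \<ge> 1" by linarith
    thus ?thesis
    proof cases
      case 1
      thus ?thesis using step[of t 0] lt0[of 0] range(1)[of t] by simp
    next
      case 2
      thus ?thesis using upper[of t] range(1)[of t] bounds(2)[of t] by (cases "t = 0") auto
    qed (simp add: le1)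
  qed
  thus "prob {\<omega>\<in>space M. F (X \<omega>) \<le> t} = min 1 (max 0 t)" by (simp add: le_def)
  have lt: "lt t = min 1 (max 0 t)" for t
  proof -
    consider "t \<le> 0" | "0 < t" "t < 1" | "t = 1" | "t > 1" by linarith
    thus ?thesis
    proof cases
      case 2
      thus ?thesis using lower[of t] bounds(1)[of t] by simp
    next
      case 3
      thus ?thesis using lower[of t] range(4)[of t] by simp
    next
      case 4
      thus ?thesis using step[of 1 t] le1[of 1] range(4)[of t] by simp
    qed (simp add: lt0)
  qed
  have "{\<omega>\<in>space M. 1 - F (X \<omega>) \<le> t} = space M - {\<omega>\<in>space M. F (X \<omega>) < 1 - t}" by auto
  also have "prob \<dots> = 1 - lt (1 - t)" unfolding lt_def by (intro prob_compl) auto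
  finally show "prob {\<omega>\<in>space M. 1 - F (X \<omega>) \<le> t} = min 1 (max 0 t)" by (auto simp: lt)
qed

section \<open>Bounds for empirical distribution functions and the supremum metric\<close>

lemma empirical_df_eq: "empirical_df X n \<omega> x = card {i\<in>{1..n}. X i \<omega> \<le> x} / n"
  by (simp add: empirical_df_def sum_of_bool_eq Int_def)

lemma empirical_df_range: "range (empirical_df X n \<omega>) \<subseteq> {0..1}"
proof safe
  fix x
  have "card {i\<in>{1..n}. X i \<omega> \<le> x} \<le> card {1..n}" by (intro card_mono) auto
  \<comment> \<open>At \<open>n = 0\<close> division by zero yields \<open>0\<close>, so the index 0
    of the sequence is covered too.\<close>
  thus "empirical_df X n \<omega> x \<in> {0..1}" by (cases "n = 0") (simp_all add: empirical_df_eq)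
qed

lemma bdd_above_abs_diff_unit:
  fixes A B :: "'b \<Rightarrow> real"
  assumes "range A \<subseteq> {0..1}" "range B \<subseteq> {0..1}"
  shows "bdd_above ((\<lambda>x. \<bar>A x - B x\<bar>) ` S)"
proof (rule bdd_aboveI2)
  fix x
  have "A x \<in> {0..1}" "B x \<in> {0..1}" using assms by blast+
  thus "\<bar>A x - B x\<bar> \<le> 1" by auto
qed

text \<open>Removes \<open>G\<close> from the problem by the triangle inequality in both directions.
  The unit ranges make the suprema genuine upper bounds.\<close>

lemma KS_distance_diff_le:
  assumes A: "range A \<subseteq> {0..1}" and F: "range F \<subseteq> {0..1}" and G: "range G \<subseteq> {0..1}"
  shows "\<bar>KS_distance A G - KS_distance F G\<bar> \<le> KS_distance A F"
proof -
  have up: "\<bar>A x - B x\<bar> \<le> KS_distance A B"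
    if "range A \<subseteq> {0..1}" "range B \<subseteq> {0..1}" for A B x
    unfolding KS_distance_def using that by (intro cSUP_upper bdd_above_abs_diff_unit) auto
  have "KS_distance A G \<le> KS_distance A F + KS_distance F G"
    unfolding KS_distance_def[of A G]
  proof (rule cSUP_least)
    fix x show "\<bar>A x - G x\<bar> \<le> KS_distance A F + KS_distance F G"
      using up[OF A F, of x] up[OF F G, of x] by linarith
  qed simp
  moreover have "KS_distance F G \<le> KS_distance A F + KS_distance A G"
    unfolding KS_distance_def[of F G]
  proof (rule cSUP_least)
    fix x show "\<bar>F x - G x\<bar> \<le> KS_distance A F + KS_distance A G"
      using up[OF A F, of x] up[OF A G, of x] by linarith
  qed simp
  ultimately show ?thesis by linarith
qed

section \<open>Measurability of the distance through a countable supremum\<close>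

lemma empirical_df_continuous_at_right: "(empirical_df X n \<omega> \<longlongrightarrow> empirical_df X n \<omega> x) (at_right x)"
proof -
  have "((\<lambda>y. of_bool (a \<le> y) :: real) \<longlongrightarrow> of_bool (a \<le> x)) (at_right x)" for a :: real
  proof (rule tendsto_eventually)
    show "\<forall>\<^sub>F y in at_right x. (of_bool (a \<le> y) :: real) = of_bool (a \<le> x)"
    proof (cases "a \<le> x")
      case True
      thus ?thesis by (auto simp: eventually_at_filter)
    next
      case False
      hence "\<forall>\<^sub>F y in at_right x. y < a" by (auto simp: eventually_at_right_field intro: exI[of _ a])
      thus ?thesis using False by (auto elim: eventually_mono)
    qed
  qed
  thus ?thesis unfolding empirical_df_def by (intro tendsto_intros)
qed

text \<open>A value above the rational supremum would stay above it just to the right, where there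
  are rationals.\<close>

lemma SUP_right_continuous_eq_SUP_Rats:
  fixes h :: "real \<Rightarrow> real"
  assumes h: "\<And>x. (h \<longlongrightarrow> h x) (at_right x)" and bdd: "bdd_above (range h)"
  shows "(SUP x. h x) = (SUP x\<in>\<rat>. h x)"
proof (rule antisym)
  have bddQ: "bdd_above (h ` \<rat>)" using bdd by (rule bdd_above_mono) auto
  show "(SUP x. h x) \<le> (SUP x\<in>\<rat>. h x)"
  proof (rule cSUP_least)
    fix x show "h x \<le> (SUP x\<in>\<rat>. h x)"
    proof (rule ccontr)
      assume "\<not> h x \<le> (SUP x\<in>\<rat>. h x)"
      hence "\<forall>\<^sub>F y in at_right x. h y > (SUP x\<in>\<rat>. h x)"
        using order_tendstoD(1)[OF h] by simp
      then obtain b where b: "b > x" "\<And>y. x < y \<Longrightarrow> y < b \<Longrightarrow> h y > (SUP x\<in>\<rat>. h x)"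
        by (auto simp: eventually_at_right_field)
      obtain q where q: "q \<in> \<rat>" "x < q" "q < b" using Rats_dense_in_real[OF b(1)] by blast
      have "h q \<le> (SUP x\<in>\<rat>. h x)" using q(1) bddQ by (rule cSUP_upper)
      thus False using b(2)[OF q(2,3)] by simp
    qed
  qed simp
  show "(SUP x\<in>\<rat>. h x) \<le> (SUP x. h x)"
    using bdd by (intro cSUP_subset_mono) (auto intro: Rats_0)
qed

lemma KS_distance_empirical_measurable:
  assumes X: "\<And>i. i \<ge> 1 \<Longrightarrow> X i \<in> borel_measurable M"
    and G: "distribution_function G" "continuous_on UNIV G"
  shows "(\<lambda>\<omega>. KS_distance (empirical_df X n \<omega>) G) \<in> borel_measurable M"
proof -
  have bdd: "bdd_above ((\<lambda>x. \<bar>empirical_df X n \<omega> x - G x\<bar>) ` S)" for \<omega> S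
    using empirical_df_range distribution_function_range[OF G(1)] by (rule bdd_above_abs_diff_unit)
  have "KS_distance (empirical_df X n \<omega>) G = (SUP x\<in>\<rat>. \<bar>empirical_df X n \<omega> x - G x\<bar>)" for \<omega>
    unfolding KS_distance_def
  proof (rule SUP_right_continuous_eq_SUP_Rats)
    fix x
    have "(G \<longlongrightarrow> G x) (at x)"
      using G(2) by (simp add: continuous_on_eq_continuous_at isCont_def)
    hence "(G \<longlongrightarrow> G x) (at_right x)" by (rule tendsto_within_subset) simp
    thus "((\<lambda>x. \<bar>empirical_df X n \<omega> x - G x\<bar>) \<longlongrightarrow> \<bar>empirical_df X n \<omega> x - G x\<bar>) (at_right x)"
      by (rule tendsto_rabs[OF tendsto_diff[OF empirical_df_continuous_at_right]])
  qed (rule bdd)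
  moreover have "(\<lambda>\<omega>. SUP x\<in>\<rat>. \<bar>empirical_df X n \<omega> x - G x\<bar>) \<in> borel_measurable M"
  proof (intro borel_measurable_cSUP bdd countable_rat)
    fix x
    have "(\<lambda>\<omega>. \<Sum>i = 1..n. of_bool (X i \<omega> \<le> x) :: real) \<in> borel_measurable M"
    proof (rule borel_measurable_sum)
      fix i assume "i \<in> {1..n}"
      hence [measurable]: "X i \<in> borel_measurable M" using X by simp
      show "(\<lambda>\<omega>. of_bool (X i \<omega> \<le> x) :: real) \<in> borel_measurable M" by measurable
    qed
    thus "(\<lambda>\<omega>. \<bar>empirical_df X n \<omega> x - G x\<bar>) \<in> borel_measurable M"
      unfolding empirical_df_def by measurable
  qed
  ultimately show ?thesis by simp
qed

text \<open>The factor 2 is the union bound over upper and lower deviations. An exceptional event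
  \<open>E\<close> is supplied instead of the deviation event itself, so measurability of the
  supremum is not at issue here.\<close>

theorem (in prob_space) dvoretzky_kiefer_wolfowitz_massart:
  assumes F: "distribution_function F" "continuous_on UNIV F"
    and ind: "indep_vars (\<lambda>_. borel) X {1..n}"
    and cdf: "\<And>i. i \<in> {1..n} \<Longrightarrow> cdf (distr M borel (X i)) = F"
    and "n \<ge> 1" "0 < e"
  obtains E where "E \<in> events" "prob E \<le> 2 * exp (- 2 * real n * e\<^sup>2)"
    "\<And>\<omega>. \<omega> \<in> space M \<Longrightarrow> \<omega> \<notin> E \<Longrightarrow> KS_distance (empirical_df X n \<omega>) F \<le> e"
proof -
  let ?I = "{1..n}"
  note F01 = distribution_function_bounds[OF F(1)]
  have Fm[measurable]: "F \<in> borel_measurable borel"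
    using F(2) by (rule borel_measurable_continuous_onI)
  have Xm: "X i \<in> borel_measurable M" if "i \<in> ?I" for i
    using ind that by (auto simp: indep_vars_def)
  define E where "E U = {\<omega>\<in>space M. \<exists>k\<le>n. n * e < k \<and> k \<le> card {i\<in>?I. U i \<omega> \<le> k / n - e}}"
    for U :: "nat \<Rightarrow> 'a \<Rightarrow> real"
  define U V where "U i \<omega> = F (X i \<omega>)" and "V i \<omega> = 1 - F (X i \<omega>)" for i \<omega>
  have "indep_vars (\<lambda>_. borel) U ?I" "indep_vars (\<lambda>_. borel) V ?I"
    unfolding U_def V_def by (rule indep_vars_compose2[OF ind]; measurable)+
  note UV = this
  have fin: "finite ?I" "?I \<noteq> {}" using \<open>n \<ge> 1\<close> by auto
  have bound: "prob (E W) \<le> exp (- 2 * real n * e\<^sup>2) \<and> E W \<in> events"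
    if "indep_vars (\<lambda>_. borel) W ?I" "\<And>i \<omega>. i \<in> ?I \<Longrightarrow> \<omega> \<in> space M \<Longrightarrow> W i \<omega> \<le> 1"
      "\<And>i t. i \<in> ?I \<Longrightarrow> prob {\<omega>\<in>space M. W i \<omega> \<le> t} = min 1 (max 0 t)" for W
    using uniform_crossing_bound[OF that(1) fin \<open>0 < e\<close> that(2,3)] by (simp only: E_def card_atLeastAtMost diff_Suc_1 simp_thms)
  have EU: "prob (E U) \<le> exp (- 2 * real n * e\<^sup>2) \<and> E U \<in> events"
  proof (rule bound[OF UV(1)])
    fix i t assume "i \<in> ?I"
    thus "prob {\<omega>\<in>space M. U i \<omega> \<le> t} = min 1 (max 0 t)"
      unfolding U_def by (intro probability_integral_transform F Xm cdf)
  qed (simp add: U_def F01)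
  have EV: "prob (E V) \<le> exp (- 2 * real n * e\<^sup>2) \<and> E V \<in> events"
  proof (rule bound[OF UV(2)])
    fix i t assume "i \<in> ?I"
    thus "prob {\<omega>\<in>space M. V i \<omega> \<le> t} = min 1 (max 0 t)"
      unfolding V_def by (intro probability_integral_transform F Xm cdf)
  qed (simp add: V_def F01)
  have "KS_distance (empirical_df X n \<omega>) F \<le> e" if \<omega>: "\<omega> \<in> space M" "\<omega> \<notin> E U" "\<omega> \<notin> E V" for \<omega>
    unfolding KS_distance_def
  proof (rule cSUP_least)
    fix x
    define A where "A = empirical_df X n \<omega> x"
    have "A - F x \<le> e"
    proof (rule ccontr)
      assume *: "\<not> A - F x \<le> e"
      \<comment> \<open>The \<open>?k\<close> points at or below \<open>x\<close> satisfy
        \<open>U i \<omega> \<le> F x < ?k / n - e\<close>, so a deviation at any real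
        \<open>x\<close> is a crossing at index \<open>?k\<close>.\<close>
      let ?k = "card {i\<in>?I. X i \<omega> \<le> x}"
      have k: "A = ?k / n" by (simp add: A_def empirical_df_eq)
      have "?k \<le> card {i\<in>?I. U i \<omega> \<le> ?k / n - e}"
        using * k monoD[OF F01(3)] by (intro card_mono) (force simp: U_def)+
      moreover have "?k \<le> card ?I" by (intro card_mono) auto
      moreover have "n * e < ?k" 
      proof -
        have "e < ?k / n" using * k F01(1)[of x] by linarith
        thus ?thesis using \<open>n \<ge> 1\<close> by (simp add: field_simps)
      qed
      ultimately have "\<omega> \<in> E U" using \<omega>(1) unfolding E_def by auto
      thus False using \<omega> by simp
    qed
    moreover have "F x - A \<le> e"
    proof (rule ccontr)
      assume *: "\<not> F x - A \<le> e"
      \<comment> \<open>Now the points above \<open>x\<close> are counted: for them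
        \<open>V i \<omega> \<le> 1 - F x < ?k / n - e\<close>.\<close>
      let ?k = "card {i\<in>?I. \<not> X i \<omega> \<le> x}"
      have "card ?I = card {i\<in>?I. X i \<omega> \<le> x} + ?k"
      proof -
        have "card ?I = card ({i\<in>?I. X i \<omega> \<le> x} \<union> {i\<in>?I. \<not> X i \<omega> \<le> x})"
          by (rule arg_cong[where f = card]) blast
        also have "\<dots> = card {i\<in>?I. X i \<omega> \<le> x} + ?k" by (rule card_Un_disjoint) auto
        finally show ?thesis .
      qed
      hence k: "1 - A = ?k / n" using \<open>n \<ge> 1\<close> by (simp add: A_def empirical_df_eq field_simps)
      have "?k \<le> card {i\<in>?I. V i \<omega> \<le> ?k / n - e}"
      proof (intro card_mono subsetI)
        fix i assume i: "i \<in> {i\<in>?I. \<not> X i \<omega> \<le> x}"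
        hence "F x \<le> F (X i \<omega>)" by (intro monoD[OF F01(3)]) auto
        thus "i \<in> {i\<in>?I. V i \<omega> \<le> ?k / n - e}" using i * k by (simp add: V_def)
      qed simp
      moreover have "?k \<le> card ?I" by (intro card_mono) auto
      moreover have "n * e < ?k"
      proof -
        have "e < ?k / n" using * k F01(2)[of x] by linarith
        thus ?thesis using \<open>n \<ge> 1\<close> by (simp add: field_simps)
      qed
      ultimately have "\<omega> \<in> E V" using \<omega>(1) unfolding E_def by auto
      thus False using \<omega> by simp
    qed
    ultimately show "\<bar>empirical_df X n \<omega> x - F x\<bar> \<le> e" unfolding A_def by linarith
  qed simp
  moreover have "prob (E U \<union> E V) \<le> 2 * exp (- 2 * real n * e\<^sup>2)"
    using measure_Un_le[of "E U" M "E V"] EU EV by linarith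
  ultimately show ?thesis using EU EV by (intro that[of "E U \<union> E V"]) auto
qed

theorem proposition1:
  fixes M :: "'a measure"
    and X :: "nat \<Rightarrow> 'a \<Rightarrow> real"
    and F G :: "real \<Rightarrow> real"
  assumes "prob_space M"
    and "distribution_function F" and "continuous_on UNIV F"
    and "distribution_function G" and "continuous_on UNIV G"
    and "prob_space.indep_vars M (\<lambda>_. borel) X {1..}"
    and "\<And>i. i \<ge> 1 \<Longrightarrow> cdf (distr M borel (X i)) = F"
  shows "converges_in_probability M
           (\<lambda>n \<omega>. KS_distance (empirical_df X n \<omega>) G) (\<lambda>_. KS_distance F G) \<and>
         (\<forall>n\<ge>1. \<forall>z\<ge>0.
           measure M {\<omega> \<in> space M.
             sqrt (real n) * \<bar>KS_distance (empirical_df X n \<omega>) G - KS_distance F G\<bar> > z}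
           \<le> 2 * exp (- 2 * z\<^sup>2))"
proof -
  interpret prob_space M by fact
  define \<Delta> where "\<Delta> n \<omega> = \<bar>KS_distance (empirical_df X n \<omega>) G - KS_distance F G\<bar>" for n \<omega>
  have Xm: "X i \<in> borel_measurable M" if "i \<ge> 1" for i
    using assms(6) that by (auto simp: indep_vars_def)
  note meas = KS_distance_empirical_measurable[OF Xm assms(4,5)]
  have rate: "prob {\<omega>\<in>space M. sqrt n * \<Delta> n \<omega> > z} \<le> 2 * exp (- 2 * z\<^sup>2)" if n: "n \<ge> 1" and z: "z \<ge> 0" for n :: nat and z
  \<comment> \<open>At \<open>z = 0\<close> the right-hand side is 2; otherwise
    \<open>e = z / sqrt n\<close> is positive, as the deviation inequality demands.\<close>
  proof (cases "z = 0")
    case True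
    have "prob {\<omega>\<in>space M. sqrt n * \<Delta> n \<omega> > z} \<le> 1" by (rule prob_le_1)
    moreover have "2 * exp (- 2 * z\<^sup>2) = 2" using True by simp
    ultimately show ?thesis by linarith
  next
    case False
    define e where "e = z / sqrt n"
    have e: "0 < e" "n * e\<^sup>2 = z\<^sup>2" "sqrt n * e = z"
      using False n z by (auto simp: e_def power_divide)
    have ind: "indep_vars (\<lambda>_. borel) X {1..n}" using assms(6) by (rule indep_vars_subset) auto
    have cdf: "cdf (distr M borel (X i)) = F" if "i \<in> {1..n}" for i using assms(7) that by simp
    obtain E where E: "E \<in> events" "prob E \<le> 2 * exp (- 2 * real n * e\<^sup>2)"
      "\<And>\<omega>. \<omega> \<in> space M \<Longrightarrow> \<omega> \<notin> E \<Longrightarrow> KS_distance (empirical_df X n \<omega>) F \<le> e"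
      using dvoretzky_kiefer_wolfowitz_massart[OF assms(2,3) ind cdf n e(1)] by blast
    have "{\<omega>\<in>space M. sqrt n * \<Delta> n \<omega> > z} \<subseteq> E"
    proof safe
      fix \<omega> assume \<omega>: "\<omega> \<in> space M" "sqrt n * \<Delta> n \<omega> > z"
      show "\<omega> \<in> E"
      proof (rule ccontr)
        assume "\<omega> \<notin> E"
        hence "\<Delta> n \<omega> \<le> e"
          using E(3)[OF \<omega>(1)] KS_distance_diff_le[OF empirical_df_range distribution_function_range[OF assms(2)]
              distribution_function_range[OF assms(4)], of X n \<omega>]
          by (simp add: \<Delta>_def)
        hence "sqrt n * \<Delta> n \<omega> \<le> sqrt n * e" by (intro mult_left_mono) auto
        thus False using \<omega>(2) e(3) by simp
      qed
    qed
    hence "prob {\<omega>\<in>space M. sqrt n * \<Delta> n \<omega> > z} \<le> prob E" using E(1) by (rule finite_measure_mono)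
    thus ?thesis using E(2) e(2) by (simp add: mult.assoc)
  qed
  \<comment> \<open>Convergence follows from the rate at \<open>z = sqrt n * \<epsilon>\<close>,
    which grows with \<open>n\<close>.\<close>
  have "(\<lambda>n. prob {\<omega>\<in>space M. \<Delta> n \<omega> > \<epsilon>}) \<longlonglongrightarrow> 0" if "\<epsilon> > 0" for \<epsilon>
  proof (rule tendsto_sandwich[OF _ _ tendsto_const])
    show "\<forall>\<^sub>F n in sequentially. prob {\<omega>\<in>space M. \<Delta> n \<omega> > \<epsilon>} \<le> 2 * exp (- 2 * (real n * \<epsilon>\<^sup>2))"
    proof (rule eventually_mono[OF eventually_ge_at_top])
      fix n :: nat assume n: "1 \<le> n"
      thus "prob {\<omega>\<in>space M. \<Delta> n \<omega> > \<epsilon>} \<le> 2 * exp (- 2 * (real n * \<epsilon>\<^sup>2))"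
        using rate[of n "sqrt n * \<epsilon>"] \<open>\<epsilon> > 0\<close> by (simp add: power_mult_distrib)
    qed
    have "LIM n sequentially. real n * (2 * \<epsilon>\<^sup>2) :> at_top"
      using that by (intro filterlim_at_top_mult_tendsto_pos[OF tendsto_const _ filterlim_real_sequentially] ) auto
    hence "LIM n sequentially. - (real n * (2 * \<epsilon>\<^sup>2)) :> at_bot"
      by (rule filterlim_uminus_at_top[THEN iffD1])
    hence "(\<lambda>n. exp (- (real n * (2 * \<epsilon>\<^sup>2)))) \<longlonglongrightarrow> 0"
      by (rule filterlim_compose[OF exp_at_bot])
    from tendsto_mult_left[OF this, of 2]
    show "(\<lambda>n. 2 * exp (- 2 * (real n * \<epsilon>\<^sup>2))) \<longlonglongrightarrow> 0" by (simp add: mult_ac)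
  qed auto
  thus ?thesis using meas rate by (auto simp: converges_in_probability_def \<Delta>_def)
qed

end
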